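(* Let $n\ge1$ and $k\ge2$ be integers. For each $\vec\pi\in S_n^{k-1}$, the pair $\mathfrak A(\vec\pi)=\langle B(\vec\pi),\{U(\vec x):\vec x\in L(\vec\pi)\}\rangle$ is an antimatroid with convex dimension at most $k$. Conversely, for each antimatroid $\mathfrak B$ of convex dimension $k$ on an $n$-element set, there exists a $\vec\pi\in S_n^{k-1}$ such that $\mathfrak B$ is isomorphic to $\mathfrak A(\vec\pi)$.
   Context: A pair $\langle E,\mathfrak F\rangle$ is an antimatroid if (i) $E$ is a finite set and $\emptyset\ne\mathfrak F\subseteq P(E)$; (ii) for each nonempty $A\in\mathfrak F$ there is an $x\in A$ with $A\setminus\{x\}\in\mathfrak F$; (iii) $\mathfrak F$ is closed under taking unions; (iv) $E=\bigcup\{A:A\in\mathfrak F\}$. For an antimatroid $\langle E,\mathfrak F\rangle$, the poset $\langle\mathfrak F,\subseteq\rangle$ is a (join-distributive) lattice; the convex dimension of the antimatroid is the width (maximum size of an antichain) of the poset of join-irreducible elements of this lattice (the elements with exactly one lower cover). Isomorphism of antimatroids means a bijection between ground sets inducing a bijection between the set families. $S_n$ is the group of permutations of $\{1,\dots,n\}$. For $\vec\pi=\langle\pi_{12},\dots,\pi_{1k}\rangle\in S_n^{k-1}$ put $\pi_{11}=\mathrm{id}$ and $\pi_{ij}=\pi_{1j}\circ\pi_{1i}^{-1}$ (composition from right to left). An eligible $\vec\pi$-tuple is $\vec x=\langle x_1,\dots,x_k\rangle\in\{0,1,\dots,n\}^k$ such that $\pi_{ij}(x_i+1)\ge x_j+1$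 for all $i,j\in\{1,\dots,k\}$ with $x_i<n$; $L(\vec\pi)$ is the set of eligible $\vec\pi$-tuples, ordered componentwise. A vector $\vec x\in\{1,\dots,n\}^k$ is a $\vec\pi$-orbit if $\pi_{ij}(x_i)=x_j$ for all $i,j\in\{1,\dots,k\}$. A vector $\langle y_1,\dots,y_k\rangle\in\{0,\dots,n-1\}^k$ is suborbital with respect to $\vec\pi$ if $\langle y_1+1,\dots,y_k+1\rangle$ is a $\vec\pi$-orbit. $B(\vec\pi)$ is the set of suborbital vectors with respect to $\vec\pi$; it is a subset of $L(\vec\pi)$. For $\vec x\in L(\vec\pi)$, $U(\vec x)=\{\vec y\in B(\vec\pi):\vec x\not\le\vec y\}$. *)

theory Defs
  imports "HOL-Library.FuncSet" "HOL-Combinatorics.Permutations"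
begin

definition antimatroid :: "'a set \<Rightarrow> 'a set set \<Rightarrow> bool" where
  "antimatroid E F \<longleftrightarrow>
     finite E \<and> F \<noteq> {} \<and> F \<subseteq> Pow E \<and>
     (\<forall>A\<in>F. A \<noteq> {} \<longrightarrow> (\<exists>x\<in>A. A - {x} \<in> F)) \<and>
     (\<forall>A\<in>F. \<forall>B\<in>F. A \<union> B \<in> F) \<and>
     E = \<Union>F"

definition lower_cover :: "'a set set \<Rightarrow> 'a set \<Rightarrow> 'a set \<Rightarrow> bool" where
  "lower_cover F A B \<longleftrightarrow>
     A \<in> F \<and> B \<in> F \<and> A \<subset> B \<and> \<not> (\<exists>C\<in>F. A \<subset> C \<and> C \<subset> B)"

text \<open>Here \<open>F\<close>, ordered by inclusion, is meant to be a finite lattice; an element of such a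
  lattice is join-irreducible iff it has exactly one lower cover.\<close>

definition join_irreducibles :: "'a set set \<Rightarrow> 'a set set" where
  "join_irreducibles F = {B \<in> F. \<exists>!A. lower_cover F A B}"

definition antichain :: "'a set set \<Rightarrow> bool" where
  "antichain C \<longleftrightarrow> (\<forall>A\<in>C. \<forall>B\<in>C. A \<subseteq> B \<longrightarrow> A = B)"

text \<open>The width of the poset \<open>P\<close> of sets, ordered by inclusion; meaningful for finite \<open>P\<close> only.\<close>

definition width :: "'a set set \<Rightarrow> nat" where
  "width P = Max {card C |C. C \<subseteq> P \<and> antichain C}"

text \<open>The convex dimension of an antimatroid depends on its ground set \<open>E = \<Union>F\<close> only through
  the family \<open>F\<close> of feasible sets.\<close>

definition convex_dimension :: "'a set set \<Rightarrow> nat" where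
  "convex_dimension F = width (join_irreducibles F)"

definition antimatroid_isomorphic ::
    "'a set \<Rightarrow> 'a set set \<Rightarrow> 'b set \<Rightarrow> 'b set set \<Rightarrow> bool" where
  "antimatroid_isomorphic E F E' F' \<longleftrightarrow>
     (\<exists>f. bij_betw f E E' \<and> bij_betw ((`) f) F F')"

text \<open>A \<open>k\<close>-tuple is an extensional function on \<open>{1..k}\<close>, so that equality of functions is equality
  of tuples. The tuple \<open>\<langle>\<pi>\<^bsub>12\<^esub>, \<dots>, \<pi>\<^bsub>1k\<^esub>\<rangle>\<close> of \<open>k - 1\<close> permutations is indexed by
  \<open>{2..k}\<close>: its entry at \<open>j\<close> is \<open>\<pi>\<^bsub>1j\<^esub>\<close>. A permutation of \<open>{1..n}\<close> is a bijection of \<open>nat\<close> that is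
  the identity off \<open>{1..n}\<close>.\<close>

definition perm_tuples :: "nat \<Rightarrow> nat \<Rightarrow> (nat \<Rightarrow> nat \<Rightarrow> nat) set" where
  "perm_tuples n k = {2..k} \<rightarrow>\<^sub>E {p. p permutes {1..n}}"

definition perm_from_first :: "(nat \<Rightarrow> nat \<Rightarrow> nat) \<Rightarrow> nat \<Rightarrow> nat \<Rightarrow> nat" where
  "perm_from_first \<pi> j = (if j = 1 then id else \<pi> j)"

text \<open>\<open>perm_ij \<pi> i j\<close> is \<open>\<pi>\<^bsub>ij\<^esub> = \<pi>\<^bsub>1j\<^esub> \<circ> \<pi>\<^bsub>1i\<^esub>\<^sup>-\<^sup>1\<close>.\<close>

definition perm_ij :: "(nat \<Rightarrow> nat \<Rightarrow> nat) \<Rightarrow> nat \<Rightarrow> nat \<Rightarrow> nat \<Rightarrow> nat" where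
  "perm_ij \<pi> i j = perm_from_first \<pi> j \<circ> inv (perm_from_first \<pi> i)"

definition eligible_tuples :: "nat \<Rightarrow> nat \<Rightarrow> (nat \<Rightarrow> nat \<Rightarrow> nat) \<Rightarrow> (nat \<Rightarrow> nat) set" where
  "eligible_tuples n k \<pi> =
     {x \<in> {1..k} \<rightarrow>\<^sub>E {0..n}.
        \<forall>i\<in>{1..k}. \<forall>j\<in>{1..k}. x i < n \<longrightarrow> perm_ij \<pi> i j (x i + 1) \<ge> x j + 1}"

definition tuple_le :: "nat \<Rightarrow> (nat \<Rightarrow> nat) \<Rightarrow> (nat \<Rightarrow> nat) \<Rightarrow> bool" where
  "tuple_le k x y \<longleftrightarrow> (\<forall>i\<in>{1..k}. x i \<le> y i)"

definition orbit_vectors :: "nat \<Rightarrow> nat \<Rightarrow> (nat \<Rightarrow> nat \<Rightarrow> nat) \<Rightarrow> (nat \<Rightarrow> nat) set" where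
  "orbit_vectors n k \<pi> =
     {x \<in> {1..k} \<rightarrow>\<^sub>E {1..n}. \<forall>i\<in>{1..k}. \<forall>j\<in>{1..k}. perm_ij \<pi> i j (x i) = x j}"

definition suborbital_vectors :: "nat \<Rightarrow> nat \<Rightarrow> (nat \<Rightarrow> nat \<Rightarrow> nat) \<Rightarrow> (nat \<Rightarrow> nat) set" where
  "suborbital_vectors n k \<pi> =
     {y \<in> {1..k} \<rightarrow>\<^sub>E {0..<n}. (\<lambda>i\<in>{1..k}. y i + 1) \<in> orbit_vectors n k \<pi>}"

definition suborbital_not_above ::
    "nat \<Rightarrow> nat \<Rightarrow> (nat \<Rightarrow> nat \<Rightarrow> nat) \<Rightarrow> (nat \<Rightarrow> nat) \<Rightarrow> (nat \<Rightarrow> nat) set" where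
  "suborbital_not_above n k \<pi> x = {y \<in> suborbital_vectors n k \<pi>. \<not> tuple_le k x y}"

definition eligible_feasible_sets ::
    "nat \<Rightarrow> nat \<Rightarrow> (nat \<Rightarrow> nat \<Rightarrow> nat) \<Rightarrow> (nat \<Rightarrow> nat) set set" where
  "eligible_feasible_sets n k \<pi> = suborbital_not_above n k \<pi> ` eligible_tuples n k \<pi>"

end

theory Submission
  imports Defs
begin

text \<open>
  The \<open>i\<close>-th coordinate is a bijection from the \<open>n\<close> suborbital vectors onto \<open>{0..<n}\<close>, so a tuple
  of permutations is the same thing as \<open>k\<close> linear orders on a common \<open>n\<close>-element set, and \<open>U(x)\<close> is
  a union of initial segments, the \<open>i\<close>-th one consisting of the vectors \<open>y\<close> with \<open>y i < x i\<close>.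
  Eligibility of \<open>x\<close> says that each of these segments is as long as it can be inside \<open>U(x)\<close>: the
  element following the \<open>i\<close>-th segment in the \<open>i\<close>-th order lies outside \<open>U(x)\<close>. As every union of
  initial segments can be rewritten with maximal segments, the feasible sets are exactly all the
  unions of initial segments (\<open>eligible_feasible_sets_eq_prefix_family\<close>), and everything reduces to
  families of this kind, for which \<open>prefix_family\<close> is used below.

  Such a family is an antimatroid: it is clearly closed under unions, and if a nonempty member is
  written with segments of least total length, then shortening one of them by one removes
  exactly one element. A join-irreducible member, not being a union of smaller members, is itself
  an initial segment; hence the join-irreducibles are covered by \<open>k\<close> chains, and an antichain
  contains at most one element of each.

  Conversely, let an antimatroid have convex dimension \<open>k\<close>. By Dilworth's theorem its
  join-irreducibles split into \<open>k\<close> chains. Since feasible sets can be taken apart one element at a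
  time while staying above a given feasible set, each chain extends to a maximal chain of feasible
  sets from the empty set to the ground set, that is, to a linear order all of whose initial segments
  are feasible (\<open>chain_extends_to_ranking\<close>). Every feasible set is a union of join-irreducibles, so
  the feasible sets are exactly the unions of initial segments of these \<open>k\<close> orders. Comparing the
  orders with the first one gives the permutations, and sending an element to its vector of
  positions gives the isomorphism.
\<close>

section \<open>Dilworth's theorem\<close>

abbreviation pairwise_incomparable :: "'a::order set \<Rightarrow> bool" where
  "pairwise_incomparable C \<equiv> \<forall>x\<in>C. \<forall>y\<in>C. x \<le> y \<longrightarrow> x = y"

text \<open>
  The proof is Galvin's: remove a maximal element \<open>a\<close>, let \<open>w\<close> be the width of the rest \<open>Q\<close>, and
  colour \<open>Q\<close> with \<open>w\<close> chains. In each chain take the largest element that occurs in an antichain of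
  size \<open>w\<close>; these \<open>w\<close> elements are pairwise incomparable. If none of them lies below \<open>a\<close>, adding
  \<open>a\<close> shows that the width is \<open>w + 1\<close>, which leaves a fresh colour for \<open>a\<close>. Otherwise \<open>a\<close> together
  with the part of one chain up to its chosen element is a chain whose removal lowers the width.
  The chains are given as the classes of a colouring, some of which may be empty.
\<close>

theorem dilworth:
  fixes P :: "'a::order set"
  assumes "finite P"
    and "\<And>C. C \<subseteq> P \<Longrightarrow> pairwise_incomparable C \<Longrightarrow> card C \<le> k"
  shows "\<exists>f. f ` P \<subseteq> {..<k} \<and> (\<forall>x\<in>P. \<forall>y\<in>P. f x = f y \<longrightarrow> x \<le> y \<or> y \<le> x)"
  using assms
proof (induction "card P" arbitrary: P k rule: less_induct)
  case less
  show ?case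
  proof (cases "P = {}")
    case True
    then show ?thesis by auto
  next
    case False
    obtain a where a: "a \<in> P" "\<And>x. x \<in> P \<Longrightarrow> a \<le> x \<Longrightarrow> x = a"
      using finite_has_maximal[OF less.prems(1) False] by metis
    define Q where "Q = P - {a}"
    have finQ: "finite Q" and QP: "Q \<subseteq> P" and PQ: "P = insert a Q" and aQ: "a \<notin> Q"
      using less.prems(1) a(1) by (auto simp: Q_def)
    have cardQ: "card Q < card P"
      using finQ aQ by (simp add: PQ)
    define S where "S = {C. C \<subseteq> Q \<and> pairwise_incomparable C}"
    have finS: "finite S"
      by (rule finite_subset[of _ "Pow Q"]) (auto simp: S_def finQ)
    have "{} \<in> S" by (simp add: S_def)
    define w where "w = Max (card ` S)"
    have le_w: "card C \<le> w" if "C \<subseteq> Q" "pairwise_incomparable C" for C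
      unfolding w_def using finS that by (intro Max_ge) (auto simp: S_def)
    have "w \<in> card ` S"
      unfolding w_def using finS \<open>{} \<in> S\<close> by (intro Max_in) auto
    then obtain C0 where C0: "C0 \<subseteq> Q" "pairwise_incomparable C0" "card C0 = w"
      by (auto simp: S_def)
    have wk: "w \<le> k" using less.prems(2)[OF subset_trans[OF C0(1) QP] C0(2)] C0(3) by simp
    obtain f where fw: "f ` Q \<subseteq> {..<w}"
      and fchain: "\<And>x y. x \<in> Q \<Longrightarrow> y \<in> Q \<Longrightarrow> f x = f y \<Longrightarrow> x \<le> y \<or> y \<le> x"
      using less.hyps[OF cardQ finQ, of w] le_w by meson
    have meets: "\<exists>x\<in>C. f x = i"
      if C: "C \<subseteq> Q" "pairwise_incomparable C" "card C = w" and i: "i < w" for C i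
    proof -
      have "inj_on f C"
        using C fchain by (intro inj_onI) (metis subsetD)
      moreover have "f ` C \<subseteq> {..<w}" using C(1) fw by blast
      ultimately have "f ` C = {..<w}"
        using C(3) by (intro card_subset_eq) (auto simp: card_image)
      then show ?thesis using i by (metis imageE lessThan_iff)
    qed
    \<comment> \<open>\<open>T i\<close>: the elements of the \<open>i\<close>-th chain that lie in some antichain of maximum size\<close>
    define T where
      "T i = {x \<in> Q. f x = i \<and> (\<exists>C\<subseteq>Q. pairwise_incomparable C \<and> card C = w \<and> x \<in> C)}" for i
    have "\<exists>x\<in>T i. \<forall>y\<in>T i. y \<le> x" if i: "i < w" for i
    proof -
      have "finite (T i)" using finQ by (simp add: T_def)
      moreover have "T i \<noteq> {}" using meets[OF C0 i] C0 by (auto simp: T_def)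
      ultimately obtain x where x: "x \<in> T i" "\<And>y. y \<in> T i \<Longrightarrow> x \<le> y \<Longrightarrow> x = y"
        using finite_has_maximal[of "T i"] by metis
      have "y \<le> x" if "y \<in> T i" for y
      proof -
        have "x \<le> y \<or> y \<le> x" using x(1) that by (intro fchain) (auto simp: T_def)
        then show ?thesis using x(2)[OF that] by auto
      qed
      then show ?thesis using x(1) by blast
    qed
    then obtain x where xT: "\<And>i. i < w \<Longrightarrow> x i \<in> T i"
      and xmax: "\<And>i y. i < w \<Longrightarrow> y \<in> T i \<Longrightarrow> y \<le> x i"
      by metis
    have xQ: "x i \<in> Q" and fx: "f (x i) = i" if "i < w" for i
      using xT[OF that] by (auto simp: T_def)
    have incx: "\<not> x j \<le> x i" if ij: "i < w" "j < w" "i \<noteq> j" for i j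
    proof
      assume le: "x j \<le> x i"
      obtain C where C: "C \<subseteq> Q" "pairwise_incomparable C" "card C = w" "x i \<in> C"
        using xT[OF ij(1)] by (auto simp: T_def)
      obtain y where y: "y \<in> C" "f y = j" using meets[OF C(1-3) ij(2)] by blast
      have "y \<in> T j" using y C by (auto simp: T_def)
      then have "y \<le> x i" using xmax[OF ij(2)] le by fastforce
      then have "y = x i" using C y by blast
      then show False using y fx ij by auto
    qed
    show ?thesis
    proof (cases "\<exists>i<w. x i \<le> a")
      case False
      have "card (x ` {..<w}) = w"
        using fx by (subst card_image) (auto intro!: inj_on_inverseI[of _ f])
      then have "card (insert a (x ` {..<w})) = Suc w"
        using aQ xQ by (subst card_insert_disjoint) auto
      moreover have "card (insert a (x ` {..<w})) \<le> k"
      proof (rule less.prems(2))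
        show "insert a (x ` {..<w}) \<subseteq> P" using xQ PQ by auto
        have "\<not> a \<le> x i" if "i < w" for i
          using a(2)[of "x i"] xQ[OF that] PQ aQ by auto
        then show "pairwise_incomparable (insert a (x ` {..<w}))"
          using False incx by auto
      qed
      ultimately have "Suc w \<le> k" by simp
      define h where "h = f(a := w)"
      have "h ` P \<subseteq> {..<k}"
        using fw \<open>Suc w \<le> k\<close> by (auto simp: h_def PQ)
      moreover have "u \<le> v \<or> v \<le> u" if "u \<in> P" "v \<in> P" "h u = h v" for u v
      proof -
        have "f z < w" if "z \<in> Q" for z using fw that by blast
        then show ?thesis
          using that fchain[of u v] by (auto simp: h_def PQ split: if_splits)
      qed
      ultimately show ?thesis by blast
    next
      case True
      then obtain i where i: "i < w" "x i \<le> a" by blast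
      define K where "K = insert a {z \<in> Q. f z = i \<and> z \<le> x i}"
      define R where "R = P - K"
      have RQ: "R \<subseteq> Q" by (auto simp: R_def K_def PQ)
      have finR: "finite R" using RQ finQ finite_subset by blast
      have cardR: "card R < card P"
        using card_mono[OF finQ RQ] cardQ by simp
      \<comment> \<open>An antichain of size \<open>w\<close> would meet chain \<open>i\<close> in an element of \<open>T i\<close>, all of which lie in \<open>K\<close>.\<close>
      have "card C \<le> w - 1" if C: "C \<subseteq> R" "pairwise_incomparable C" for C
      proof -
        have CQ: "C \<subseteq> Q" using C RQ by blast
        have "card C \<noteq> w"
        proof
          assume cw: "card C = w"
          obtain z where z: "z \<in> C" "f z = i" using meets[OF CQ C(2) cw i(1)] by blast
          then have "z \<in> T i" using CQ C cw by (auto simp: T_def)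
          then have "z \<in> K" using xmax[OF i(1)] by (auto simp: K_def T_def)
          then show False using z C by (auto simp: R_def)
        qed
        then show ?thesis using le_w[OF CQ C(2)] by simp
      qed
      then obtain g where gw: "g ` R \<subseteq> {..<w - 1}"
        and gchain: "\<And>x y. x \<in> R \<Longrightarrow> y \<in> R \<Longrightarrow> g x = g y \<Longrightarrow> x \<le> y \<or> y \<le> x"
        using less.hyps[OF cardR finR, of "w - 1"] by meson
      have Kchain: "u \<le> v \<or> v \<le> u" if "u \<in> K" "v \<in> K" for u v
        using that fchain[of u v] i(2) by (auto simp: K_def)
      define h where "h z = (if z \<in> K then w - 1 else g z)" for z
      have gz: "g z < w - 1" if "z \<in> P" "z \<notin> K" for z
        using gw that unfolding R_def by blast
      have hK: "h z = w - 1 \<longleftrightarrow> z \<in> K" if "z \<in> P" for z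
        using gz[OF that] by (auto simp: h_def)
      have "h z < k" if "z \<in> P" for z
        using gz[OF that] wk i(1) by (cases "z \<in> K") (simp_all add: h_def)
      then have "h ` P \<subseteq> {..<k}" by blast
      moreover have "u \<le> v \<or> v \<le> u" if "u \<in> P" "v \<in> P" "h u = h v" for u v
      proof (cases "u \<in> K")
        case True
        then show ?thesis using hK that Kchain by metis
      next
        case False
        then have "v \<notin> K" using hK that by metis
        then show ?thesis using False that gchain[of u v] by (auto simp: h_def R_def)
      qed
      ultimately show ?thesis by blast
    qed
  qed
qed

section \<open>Unions of initial segments of linear orders\<close>

text \<open>
  The functions \<open>r i\<close> are the positions in the linear orders, counted from \<open>0\<close> so that \<open>z i\<close> is the
  length of the \<open>i\<close>-th initial segment. With this convention the coordinates of a suborbital vector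
  are its positions.
\<close>

definition prefix_union :: "'a set \<Rightarrow> 'i set \<Rightarrow> ('i \<Rightarrow> 'a \<Rightarrow> nat) \<Rightarrow> ('i \<Rightarrow> nat) \<Rightarrow> 'a set" where
  "prefix_union E I r z = {e \<in> E. \<exists>i\<in>I. r i e < z i}"

definition prefix_family :: "'a set \<Rightarrow> 'i set \<Rightarrow> ('i \<Rightarrow> 'a \<Rightarrow> nat) \<Rightarrow> 'a set set" where
  "prefix_family E I r = range (prefix_union E I r)"

lemma prefix_familyI: "prefix_union E I r z \<in> prefix_family E I r"
  by (simp add: prefix_family_def)

lemma prefix_union_zero: "prefix_union E I r (\<lambda>_. 0) = {}"
  by (simp add: prefix_union_def)

lemma initial_segment_in_prefix_family:
  assumes "i \<in> I"
  shows "{e \<in> E. r i e < m} \<in> prefix_family E I r"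
proof -
  have "{e \<in> E. r i e < m} = prefix_union E I r (\<lambda>j. if j = i then m else 0)"
    using assms by (auto simp: prefix_union_def split: if_splits)
  then show ?thesis by (simp add: prefix_familyI)
qed

lemma prefix_family_Un:
  assumes "A \<in> prefix_family E I r" "B \<in> prefix_family E I r"
  shows "A \<union> B \<in> prefix_family E I r"
proof -
  obtain y z where "A = prefix_union E I r y" "B = prefix_union E I r z"
    using assms by (auto simp: prefix_family_def)
  then have "A \<union> B = prefix_union E I r (\<lambda>i. max (y i) (z i))"
    by (auto simp: prefix_union_def less_max_iff_disj)
  then show ?thesis by (simp add: prefix_familyI)
qed

text \<open>
  Take segment lengths with least sum and shorten a nonempty segment by one. By minimality the
  union becomes smaller, and only the last element of that segment can have been lost.
\<close>

lemma prefix_family_accessible: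
  assumes I: "finite I" and inj: "\<And>i. i \<in> I \<Longrightarrow> inj_on (r i) E"
    and A: "A \<in> prefix_family E I r" "A \<noteq> {}"
  shows "\<exists>x\<in>A. A - {x} \<in> prefix_family E I r"
proof -
  obtain z0 where "prefix_union E I r z0 = A"
    using A(1) by (auto simp: prefix_family_def)
  from ex_has_least_nat[of "\<lambda>z. prefix_union E I r z = A", OF this, of "\<lambda>z. sum z I"]
  obtain z where z: "prefix_union E I r z = A"
    and zmin: "\<And>y. prefix_union E I r y = A \<Longrightarrow> sum z I \<le> sum y I"
    by blast
  obtain i where i: "i \<in> I" "z i > 0"
    using A(2) z unfolding prefix_union_def by fastforce
  define y where "y = z(i := z i - 1)"
  have "sum y I < sum z I"
    using I i by (intro sum_strict_mono_ex1) (auto simp: y_def)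
  then have ne: "prefix_union E I r y \<noteq> A" using zmin[of y] by auto
  have sub: "prefix_union E I r y \<subseteq> A"
  proof -
    have "y j \<le> z j" for j by (simp add: y_def)
    then show ?thesis unfolding z[symmetric] prefix_union_def by (blast intro: less_le_trans)
  qed
  then obtain x where x: "x \<in> A" "x \<notin> prefix_union E I r y" using ne by blast
  have last: "r i e = z i - 1" "e \<in> E" if e: "e \<in> A" "e \<notin> prefix_union E I r y" for e
  proof -
    obtain j where j: "j \<in> I" "r j e < z j" "e \<in> E"
      using e(1) z by (auto simp: prefix_union_def)
    then have nl: "\<not> r j e < y j" using e(2) by (auto simp: prefix_union_def)
    then have "j = i" using j by (auto simp: y_def split: if_splits)
    then show "r i e = z i - 1" "e \<in> E" using nl j by (auto simp: y_def)
  qed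
  have "e = x" if "e \<in> A" "e \<notin> prefix_union E I r y" for e
    using last[OF that] last[OF x] inj_onD[OF inj[OF i(1)], of e x] by simp
  then have "A - {x} = prefix_union E I r y" using sub x by blast
  then show ?thesis using x(1) prefix_familyI by metis
qed

lemma antimatroid_prefix_family:
  assumes E: "finite E" and I: "finite I" "I \<noteq> {}"
    and inj: "\<And>i. i \<in> I \<Longrightarrow> inj_on (r i) E"
  shows "antimatroid E (prefix_family E I r)"
proof -
  have Pow: "prefix_family E I r \<subseteq> Pow E"
    by (auto simp: prefix_family_def prefix_union_def)
  obtain i where i: "i \<in> I" using I by blast
  have "{e \<in> E. r i e < Suc (Max (r i ` E))} = E"
    using E by (auto simp: less_Suc_eq_le)
  then have "E \<in> prefix_family E I r"
    using initial_segment_in_prefix_family[OF i, of E r "Suc (Max (r i ` E))"] by simp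
  then show ?thesis
    unfolding antimatroid_def
    using E Pow prefix_family_accessible[OF I(1) inj] prefix_family_Un[of _ E I r]
    by (auto simp: subset_eq)
qed

section \<open>Join-irreducible feasible sets\<close>

lemma lower_cover_above:
  assumes "finite F" and "A \<in> F" "B \<in> F" "A \<subset> B"
  shows "\<exists>C. lower_cover F C B \<and> A \<subseteq> C"
proof -
  let ?S = "{C \<in> F. A \<subseteq> C \<and> C \<subset> B}"
  have "finite ?S" "?S \<noteq> {}" using assms by auto
  from finite_has_maximal[OF this]
  obtain C where C: "C \<in> ?S" "\<forall>D\<in>?S. C \<subseteq> D \<longrightarrow> C = D" ..
  then have "\<not> (\<exists>D\<in>F. C \<subset> D \<and> D \<subset> B)" by blast
  then have "lower_cover F C B"
    using assms C by (auto simp: lower_cover_def)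
  then show ?thesis using C by blast
qed

lemma finite_prefix_family:
  assumes "finite E"
  shows "finite (prefix_family E I r)"
  by (rule finite_subset[of _ "Pow E"])
    (auto simp: prefix_family_def prefix_union_def assms)

text \<open>
  If all the segments whose union is \<open>B\<close> were proper subsets of \<open>B\<close>, they would lie below the unique
  lower cover of \<open>B\<close>, and so would their union.
\<close>

lemma join_irreducible_prefix_union:
  assumes E: "finite E" and B: "B \<in> join_irreducibles (prefix_family E I r)"
  shows "\<exists>i\<in>I. \<exists>m. B = {e \<in> E. r i e < m}"
proof (rule ccontr)
  assume no: "\<not> ?thesis"
  let ?F = "prefix_family E I r"
  obtain C where C: "lower_cover ?F C B" "\<And>D. lower_cover ?F D B \<Longrightarrow> D = C"
    and BF: "B \<in> ?F"
    using B by (auto simp: join_irreducibles_def)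
  obtain z where z: "B = prefix_union E I r z"
    using BF by (auto simp: prefix_family_def)
  have "{e \<in> E. r i e < z i} \<subseteq> C" if i: "i \<in> I" for i
  proof -
    have "{e \<in> E. r i e < z i} \<subset> B"
      using no i z by (auto simp: prefix_union_def)
    then show ?thesis
      using lower_cover_above[OF finite_prefix_family[OF E]
          initial_segment_in_prefix_family[OF i] BF] C(2) by metis
  qed
  then have "B \<subseteq> C" unfolding z by (auto simp: prefix_union_def)
  then show False using C(1) by (auto simp: lower_cover_def)
qed

lemma finite_card_antichains:
  assumes "finite P"
  shows "finite {card C |C. C \<subseteq> P \<and> antichain C}"
proof -
  have "{card C |C. C \<subseteq> P \<and> antichain C} = card ` {C. C \<subseteq> P \<and> antichain C}" by blast
  then show ?thesis using assms by simp
qed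

lemma card_antichain_le_width:
  assumes "finite P" "C \<subseteq> P" "antichain C"
  shows "card C \<le> width P"
  unfolding width_def using assms finite_card_antichains by (intro Max_ge) auto

lemma width_leI:
  assumes "finite P" and "\<And>C. C \<subseteq> P \<Longrightarrow> antichain C \<Longrightarrow> card C \<le> k"
  shows "width P \<le> k"
proof -
  have "0 \<in> {card C |C. C \<subseteq> P \<and> antichain C}"
    by (intro CollectI exI[of _ "{}"]) (simp add: antichain_def)
  then show ?thesis
    unfolding width_def using assms finite_card_antichains[OF assms(1)]
    by (subst Max_le_iff) auto
qed

lemma convex_dimension_prefix_family:
  assumes E: "finite E" and I: "finite I"
  shows "convex_dimension (prefix_family E I r) \<le> card I"
  unfolding convex_dimension_def
proof (rule width_leI)
  let ?J = "join_irreducibles (prefix_family E I r)"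
  show "finite ?J"
    by (rule finite_subset[OF _ finite_prefix_family[OF E]]) (auto simp: join_irreducibles_def)
  fix C assume C: "C \<subseteq> ?J" "antichain C"
  define segment where "segment i B \<longleftrightarrow> (\<exists>m. B = {e \<in> E. r i e < m})" for i B
  have "\<forall>B\<in>C. \<exists>i. i \<in> I \<and> segment i B"
    using join_irreducible_prefix_union[OF E] C(1) unfolding segment_def by blast
  then obtain h where h: "\<And>B. B \<in> C \<Longrightarrow> h B \<in> I \<and> segment (h B) B"
    by metis
  have "inj_on h C"
  proof (rule inj_onI)
    fix A B assume AB: "A \<in> C" "B \<in> C" "h A = h B"
    then obtain i l m where lm: "A = {e \<in> E. r i e < l}" "B = {e \<in> E. r i e < m}"
      using h unfolding segment_def by metis
    have "A \<subseteq> B \<or> B \<subseteq> A"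
      unfolding lm by (cases "l \<le> m") auto
    then show "A = B" using C(2) AB by (auto simp: antichain_def)
  qed
  then show "card C \<le> card I" using h I by (intro card_inj_on_le[of h]) auto
qed

section \<open>Representing an antimatroid by linear orders\<close>

lemma antimatroid_empty:
  assumes "antimatroid E F"
  shows "{} \<in> F"
proof -
  have "\<exists>A. A \<in> F" using assms by (auto simp: antimatroid_def)
  then obtain A where A: "A \<in> F" "\<And>B. B \<in> F \<Longrightarrow> card A \<le> card B"
    using ex_has_least_nat[of "\<lambda>A. A \<in> F" _ card] by blast
  have "finite A" using assms A(1) by (auto simp: antimatroid_def intro: finite_subset)
  have "A = {}"
  proof (rule ccontr)
    assume "A \<noteq> {}"
    then obtain x where "x \<in> A" "A - {x} \<in> F"
      using assms A(1) unfolding antimatroid_def by blast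
    then show False using A(2)[of "A - {x}"] card_Diff1_less[OF \<open>finite A\<close>] by fastforce
  qed
  then show ?thesis using A by simp
qed

lemma antimatroid_Union:
  assumes "antimatroid E F" and "finite G" "G \<subseteq> F"
  shows "\<Union>G \<in> F"
  using assms(2,3)
proof (induction G rule: finite_induct)
  case empty
  then show ?case using antimatroid_empty[OF assms(1)] by simp
next
  case (insert A G)
  then show ?case using assms(1) by (simp add: antimatroid_def)
qed

text \<open>
  Remove elements from \<open>A\<close> one at a time within the family and add \<open>M\<close> back after each removal: the
  first removal that is not undone by \<open>M\<close> gives \<open>x\<close>. Instead of following such a sequence, the proof
  takes a feasible set \<open>B\<close> of least cardinality with \<open>B \<union> M = A\<close>, from which no removal is undone.
\<close>

lemma antimatroid_remove_above:
  assumes F: "antimatroid E F" and AM: "A \<in> F" "M \<in> F" "M \<subset> A"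
  shows "\<exists>x\<in>A - M. A - {x} \<in> F"
proof -
  have "A \<in> F \<and> A \<union> M = A" using AM by blast
  from ex_has_least_nat[of "\<lambda>B. B \<in> F \<and> B \<union> M = A", OF this, of card]
  obtain B where B: "B \<in> F" "B \<union> M = A"
    and least: "\<And>D. D \<in> F \<Longrightarrow> D \<union> M = A \<Longrightarrow> card B \<le> card D"
    by blast
  have "finite B" using F B(1) by (auto simp: antimatroid_def intro: finite_subset)
  have "B \<noteq> {}" using B AM by auto
  then obtain x where x: "x \<in> B" "B - {x} \<in> F"
    using F B(1) unfolding antimatroid_def by blast
  have "(B - {x}) \<union> M \<noteq> A"
    using least[OF x(2)] card_Diff1_less[OF \<open>finite B\<close> x(1)] by auto
  then have "x \<in> A - M" "(B - {x}) \<union> M = A - {x}" using B x by auto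
  then show ?thesis using F x(2) AM(2) by (metis antimatroid_def)
qed

text \<open>
  The ranking is built from the top: the last element of \<open>A\<close> is one whose removal leaves a feasible
  set that still contains all members of the chain other than \<open>A\<close>. Every member of the chain then
  is an initial segment, and its length must be its cardinality.
\<close>

lemma chain_extends_to_ranking:
  assumes F: "antimatroid E F" and "A \<in> F"
    and "C \<subseteq> F" "C \<subseteq> Pow A" and "\<And>X Y. X \<in> C \<Longrightarrow> Y \<in> C \<Longrightarrow> X \<subseteq> Y \<or> Y \<subseteq> X"
  shows "\<exists>r. bij_betw r A {0..<card A} \<and> (\<forall>m. {e \<in> A. r e < m} \<in> F) \<and>
             (\<forall>X\<in>C. X = {e \<in> A. r e < card X})"
  using assms(2-)
proof (induction "card A" arbitrary: A C)
  case 0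
  have "finite A" using F 0 by (auto simp: antimatroid_def intro: finite_subset)
  then have "A = {}" using 0 by simp
  then have "bij_betw (\<lambda>_. 0) A {0..<card A}" by (simp add: bij_betw_def)
  then show ?case using 0 \<open>A = {}\<close> antimatroid_empty[OF F] by auto
next
  case (Suc n)
  have finA: "finite A"
    using F Suc.prems(1) by (auto simp: antimatroid_def intro: finite_subset)
  define D where "D = C - {A}"
  have finD: "finite D"
    using Suc.prems(3) finA by (auto simp: D_def intro: finite_subset[of _ "Pow A"])
  have DF: "D \<subseteq> F" using Suc.prems by (auto simp: D_def)
  have "\<Union>D \<subset> A"
  proof (cases "D = {}")
    case True
    then show ?thesis using Suc.hyps(2) by auto
  next
    case False
    obtain M where M: "M \<in> D" "\<And>X. X \<in> D \<Longrightarrow> M \<subseteq> X \<Longrightarrow> M = X"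
      using finite_has_maximal[OF finD False] by metis
    have "X \<subseteq> M" if "X \<in> D" for X
      using M Suc.prems(4)[of X M] that by (auto simp: D_def)
    then have "\<Union>D = M" using M(1) by blast
    then show ?thesis using M(1) Suc.prems(3) by (auto simp: D_def)
  qed
  then obtain x where x: "x \<in> A" "x \<notin> \<Union>D" "A - {x} \<in> F"
    using antimatroid_remove_above[OF F Suc.prems(1) antimatroid_Union[OF F finD DF]] by blast
  have cardx: "card (A - {x}) = n" using x finA Suc.hyps(2) by simp
  have "D \<subseteq> Pow (A - {x})" using Suc.prems(3) x by (auto simp: D_def)
  then obtain r where r: "bij_betw r (A - {x}) {0..<n}"
    "\<And>m. {e \<in> A - {x}. r e < m} \<in> F"
    "\<And>X. X \<in> D \<Longrightarrow> X = {e \<in> A - {x}. r e < card X}"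
    using Suc.hyps(1)[of "A - {x}" D] cardx x(3) DF Suc.prems(4)
    by (auto simp: D_def)
  have rn: "r e < n" if "e \<in> A" "e \<noteq> x" for e
    using bij_betwE[OF r(1)] that by auto
  define s where "s = r(x := n)"
  have "bij_betw s (A - {x}) {0..<n}"
    using r(1) by (rule bij_betw_cong[THEN iffD1, rotated]) (auto simp: s_def)
  then have "bij_betw s ((A - {x}) \<union> {x}) ({0..<n} \<union> {n})"
    by (rule bij_betw_combine) (auto simp: s_def bij_betw_def)
  moreover have "(A - {x}) \<union> {x} = A" using x by auto
  moreover have "{0..<n} \<union> {n} = {0..<card A}" using Suc.hyps(2) by auto
  ultimately have "bij_betw s A {0..<card A}" by simp
  moreover have "{e \<in> A. s e < m} \<in> F" for m
  proof (cases "m \<le> n")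
    case True
    then have "{e \<in> A. s e < m} = {e \<in> A - {x}. r e < m}" by (auto simp: s_def)
    then show ?thesis using r(2) by simp
  next
    case False
    then have "{e \<in> A. s e < m} = A" using rn by (fastforce simp: s_def)
    then show ?thesis using Suc.prems by simp
  qed
  moreover have "X = {e \<in> A. s e < card X}" if "X \<in> C" for X
  proof (cases "X = A")
    case True
    then show ?thesis using rn Suc.hyps(2) by (fastforce simp: s_def)
  next
    case False
    then have XD: "X \<in> D" using that by (simp add: D_def)
    have "X \<subseteq> A - {x}" using XD Suc.prems(3) x by (auto simp: D_def)
    then have "card X \<le> n" using card_mono[of "A - {x}" X] finA cardx by simp
    then have "{e \<in> A. s e < card X} = {e \<in> A - {x}. r e < card X}" by (auto simp: s_def)
    then show ?thesis using r(3)[OF XD] by simp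
  qed
  ultimately show ?case by blast
qed

text \<open>
  A nonempty feasible set has a lower cover. If it is not join-irreducible it has two, and it is
  their union, because that union is feasible and strictly larger than either.
\<close>

lemma join_irreducibles_generate:
  assumes F: "antimatroid E F"
    and G: "{} \<in> G" "join_irreducibles F \<subseteq> G" "\<And>A B. A \<in> G \<Longrightarrow> B \<in> G \<Longrightarrow> A \<union> B \<in> G"
  shows "F \<subseteq> G"
proof
  have finF: "finite F" and finE: "finite E" and FE: "F \<subseteq> Pow E"
    using F by (auto simp: antimatroid_def intro: finite_subset)
  fix A assume "A \<in> F"
  then show "A \<in> G"
  proof (induction "card A" arbitrary: A rule: less_induct)
    case less
    show ?case
    proof (cases "A = {} \<or> A \<in> join_irreducibles F")
      case True
      then show ?thesis using G by auto
    next
      case False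
      have smaller: "D \<in> G" if "lower_cover F D A" for D
      proof -
        have "finite A" using less.prems FE finE by (auto intro: finite_subset)
        then have "card D < card A"
          using that by (auto simp: lower_cover_def intro: psubset_card_mono)
        then show ?thesis using less.hyps that by (auto simp: lower_cover_def)
      qed
      have "{} \<subset> A" using False by blast
      then obtain B where B: "lower_cover F B A"
        using lower_cover_above[OF finF antimatroid_empty[OF F] less.prems] by blast
      then obtain D where D: "lower_cover F D A" "D \<noteq> B"
        using False less.prems by (auto simp: join_irreducibles_def)
      have "B \<union> D \<in> F" using F B D by (auto simp: antimatroid_def lower_cover_def)
      moreover have "B \<subset> B \<union> D" "B \<union> D \<subseteq> A"
        using B D by (auto simp: lower_cover_def)
      ultimately have "B \<union> D = A" using B by (auto simp: lower_cover_def)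
      then show ?thesis using G(3) smaller B D by metis
    qed
  qed
qed

theorem antimatroid_as_prefix_family:
  assumes F: "antimatroid E F" and k: "convex_dimension F \<le> k"
  shows "\<exists>r. (\<forall>i. bij_betw (r i) E {0..<card E}) \<and> F = prefix_family E {1..k} r"
proof -
  have finE: "finite E" and FE: "F \<subseteq> Pow E" and finF: "finite F"
    using F by (auto simp: antimatroid_def intro: finite_subset)
  let ?J = "join_irreducibles F"
  have JF: "?J \<subseteq> F" by (auto simp: join_irreducibles_def)
  then have finJ: "finite ?J" using finF finite_subset by blast
  have "card C \<le> k" if "C \<subseteq> ?J" "pairwise_incomparable C" for C
    using card_antichain_le_width[OF finJ that(1)] that(2) k
    by (simp add: antichain_def convex_dimension_def)
  then obtain c where c: "c ` ?J \<subseteq> {..<k}"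
    and chain: "\<And>X Y. X \<in> ?J \<Longrightarrow> Y \<in> ?J \<Longrightarrow> c X = c Y \<Longrightarrow> X \<subseteq> Y \<or> Y \<subseteq> X"
    using dilworth[OF finJ, of k] by meson
  have "E \<in> F" using antimatroid_Union[OF F finF] F by (simp add: antimatroid_def)
  \<comment> \<open>The colours \<open>{..<k}\<close> are shifted by one to obtain the index set \<open>{1..k}\<close> of tuples.\<close>
  define ranks where
    "ranks i r \<longleftrightarrow> bij_betw r E {0..<card E} \<and> (\<forall>m. {e \<in> E. r e < m} \<in> F) \<and>
       (\<forall>X\<in>{X \<in> ?J. Suc (c X) = i}. X = {e \<in> E. r e < card X})" for i r
  have "\<exists>r. ranks i r" for i
    unfolding ranks_def
    using JF FE chain by (intro chain_extends_to_ranking[OF F \<open>E \<in> F\<close>]) auto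
  then obtain r where ranks: "\<And>i. ranks i (r i)" by metis
  then have r: "\<And>i. bij_betw (r i) E {0..<card E}" "\<And>i m. {e \<in> E. r i e < m} \<in> F"
    by (simp_all add: ranks_def)
  have rJ: "X = {e \<in> E. r (Suc (c X)) e < card X}" if "X \<in> ?J" for X
    using ranks[of "Suc (c X)"] that unfolding ranks_def by blast
  have "F \<subseteq> prefix_family E {1..k} r"
  proof (rule join_irreducibles_generate[OF F])
    show "{} \<in> prefix_family E {1..k} r"
      using prefix_familyI[of E "{1..k}" r "\<lambda>_. 0"] by (simp add: prefix_union_zero)
    show "?J \<subseteq> prefix_family E {1..k} r"
    proof
      fix X assume X: "X \<in> ?J"
      then have "Suc (c X) \<in> {1..k}" using c by fastforce
      from initial_segment_in_prefix_family[OF this, of E r "card X"] rJ[OF X]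
      show "X \<in> prefix_family E {1..k} r" by simp
    qed
  qed (rule prefix_family_Un)
  moreover have "prefix_family E {1..k} r \<subseteq> F"
  proof
    fix A assume "A \<in> prefix_family E {1..k} r"
    then obtain z where "A = prefix_union E {1..k} r z" by (auto simp: prefix_family_def)
    then have "A = \<Union>((\<lambda>i. {e \<in> E. r i e < z i}) ` {1..k})"
      by (auto simp: prefix_union_def)
    then show "A \<in> F" using antimatroid_Union[OF F] r(2) by (simp add: image_subset_iff)
  qed
  ultimately show ?thesis using r(1) by blast
qed

section \<open>Eligible tuples\<close>

lemma perm_from_first_permutes:
  assumes "\<pi> \<in> perm_tuples n k" "i \<in> {1..k}"
  shows "perm_from_first \<pi> i permutes {1..n}"
proof (cases "i = 1")
  case True
  then show ?thesis by (simp add: perm_from_first_def permutes_id)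
next
  case False
  then have "i \<in> {2..k}" using assms(2) by auto
  then show ?thesis
    using assms(1) False PiE_mem unfolding perm_tuples_def perm_from_first_def by fastforce
qed

lemma perm_ij_suborbital:
  assumes "y \<in> suborbital_vectors n k \<pi>" "i \<in> {1..k}" "j \<in> {1..k}"
  shows "perm_ij \<pi> i j (y i + 1) = y j + 1"
  using assms by (auto simp: suborbital_vectors_def orbit_vectors_def)

text \<open>
  An orbit is determined by its first coordinate \<open>m\<close>, because \<open>\<pi>\<^bsub>11\<^esub>\<close> is the identity. Hence the
  elements of \<open>{1..n}\<close> parametrise the suborbital vectors.
\<close>

lemma suborbital_vectors_eq_image:
  assumes \<pi>: "\<pi> \<in> perm_tuples n k" and k: "k \<ge> 1"
  shows "suborbital_vectors n k \<pi> = (\<lambda>m. \<lambda>i\<in>{1..k}. perm_from_first \<pi> i m - 1) ` {1..n}"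
proof (intro equalityI subsetI)
  fix y assume y: "y \<in> suborbital_vectors n k \<pi>"
  then have yP: "y \<in> {1..k} \<rightarrow>\<^sub>E {0..<n}" by (simp add: suborbital_vectors_def)
  have "perm_from_first \<pi> j (y 1 + 1) = y j + 1" if "j \<in> {1..k}" for j
    using perm_ij_suborbital[OF y _ that, of 1] k by (simp add: perm_ij_def perm_from_first_def)
  then have "y = (\<lambda>j\<in>{1..k}. perm_from_first \<pi> j (y 1 + 1) - 1)"
    using yP by (intro extensionalityI[of _ "{1..k}"]) (auto simp: PiE_iff)
  moreover have "y 1 + 1 \<in> {1..n}" using yP k by (auto simp: PiE_iff Suc_le_eq)
  ultimately show "y \<in> (\<lambda>m. \<lambda>i\<in>{1..k}. perm_from_first \<pi> i m - 1) ` {1..n}" by blast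
next
  fix y assume "y \<in> (\<lambda>m. \<lambda>i\<in>{1..k}. perm_from_first \<pi> i m - 1) ` {1..n}"
  then obtain m where m: "m \<in> {1..n}" "y = (\<lambda>i\<in>{1..k}. perm_from_first \<pi> i m - 1)" by blast
  have mem: "perm_from_first \<pi> i m \<in> {1..n}" if "i \<in> {1..k}" for i
    using permutes_in_image[OF perm_from_first_permutes[OF \<pi> that]] m(1) by blast
  have shift: "y i + 1 = perm_from_first \<pi> i m" if "i \<in> {1..k}" for i
    using mem[OF that] that m(2) by auto
  have "y \<in> {1..k} \<rightarrow>\<^sub>E {0..<n}" using mem m(2) by fastforce
  moreover have "(\<lambda>i\<in>{1..k}. y i + 1) \<in> {1..k} \<rightarrow>\<^sub>E {1..n}" using mem shift by auto
  moreover have "perm_ij \<pi> i j (y i + 1) = y j + 1" if "i \<in> {1..k}" "j \<in> {1..k}" for i j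
    using shift[OF that(1)] shift[OF that(2)]
      permutes_inverses(2)[OF perm_from_first_permutes[OF \<pi> that(1)], of m]
    by (simp add: perm_ij_def)
  ultimately show "y \<in> suborbital_vectors n k \<pi>"
    by (simp add: suborbital_vectors_def orbit_vectors_def)
qed

lemma bij_betw_suborbital_coordinate:
  assumes \<pi>: "\<pi> \<in> perm_tuples n k" and i: "i \<in> {1..k}"
  shows "bij_betw (\<lambda>y. y i) (suborbital_vectors n k \<pi>) {0..<n}"
proof -
  let ?v = "\<lambda>m. \<lambda>i\<in>{1..k}. perm_from_first \<pi> i m - 1"
  have B: "suborbital_vectors n k \<pi> = ?v ` {1..n}"
    using suborbital_vectors_eq_image[OF \<pi>] i by simp
  have p: "bij_betw (perm_from_first \<pi> i) {1..n} {1..n}"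
    by (rule permutes_imp_bij[OF perm_from_first_permutes[OF \<pi> i]])
  have "bij_betw (\<lambda>m. m - 1) {1..n} {0..<n}"
    by (rule bij_betw_byWitness[of _ Suc]) auto
  from bij_betw_trans[OF p this]
  have c: "bij_betw (\<lambda>m. ?v m i) {1..n} {0..<n}" using i by (simp add: comp_def)
  have "inj_on (\<lambda>y. y i) (?v ` {1..n})"
    using bij_betw_imp_inj_on[OF c] by (intro inj_on_imageI) (simp add: comp_def)
  moreover have "(\<lambda>y. y i) ` ?v ` {1..n} = {0..<n}"
    using c unfolding bij_betw_def image_image by blast
  ultimately show ?thesis unfolding B bij_betw_def by blast
qed

text \<open>
  When \<open>x i < n\<close> there is exactly one suborbital vector \<open>y\<close> with \<open>y i = x i\<close>; it comes
  immediately after the \<open>i\<close>-th segment, and the inequalities of eligibility at \<open>i\<close> say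
  that it is not in \<open>U(x)\<close>. When \<open>x i = n\<close> there is no such vector and both conditions are vacuous.
\<close>

lemma eligible_tuples_iff:
  assumes \<pi>: "\<pi> \<in> perm_tuples n k"
  shows "x \<in> eligible_tuples n k \<pi> \<longleftrightarrow>
    x \<in> {1..k} \<rightarrow>\<^sub>E {0..n} \<and>
    (\<forall>i\<in>{1..k}. \<forall>y\<in>suborbital_vectors n k \<pi>. y i = x i \<longrightarrow> tuple_le k x y)"
    (is "_ \<longleftrightarrow> _ \<and> ?R")
proof -
  let ?B = "suborbital_vectors n k \<pi>"
  have lt: "y i < n" if "y \<in> ?B" "i \<in> {1..k}" for y i
    using that by (auto simp: suborbital_vectors_def PiE_iff)
  have "(\<forall>j\<in>{1..k}. x i < n \<longrightarrow> perm_ij \<pi> i j (x i + 1) \<ge> x j + 1) \<longleftrightarrow>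
        (\<forall>y\<in>?B. y i = x i \<longrightarrow> tuple_le k x y)" if i: "i \<in> {1..k}" for i
  proof (cases "x i < n")
    case True
    then obtain y where y: "y \<in> ?B" "y i = x i"
      using bij_betw_imp_surj_on[OF bij_betw_suborbital_coordinate[OF \<pi> i]]
      by (metis (no_types, lifting) atLeastLessThan_iff imageE le0)
    have uniq: "y' = y" if "y' \<in> ?B" "y' i = x i" for y'
      using bij_betw_imp_inj_on[OF bij_betw_suborbital_coordinate[OF \<pi> i]] y that
      by (auto simp: inj_on_def)
    have "perm_ij \<pi> i j (x i + 1) = y j + 1" if "j \<in> {1..k}" for j
      using perm_ij_suborbital[OF y(1) i that] y(2) by simp
    then have "(\<forall>j\<in>{1..k}. x i < n \<longrightarrow> perm_ij \<pi> i j (x i + 1) \<ge> x j + 1) \<longleftrightarrow> tuple_le k x y"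
      using True by (simp add: tuple_le_def)
    also have "\<dots> \<longleftrightarrow> (\<forall>y\<in>?B. y i = x i \<longrightarrow> tuple_le k x y)"
      using y uniq by metis
    finally show ?thesis .
  next
    case False
    then show ?thesis using lt[OF _ i] by (metis (no_types, lifting))
  qed
  then show ?thesis unfolding eligible_tuples_def by blast
qed

lemma suborbital_not_above_eq_prefix_union:
  "suborbital_not_above n k \<pi> x =
     prefix_union (suborbital_vectors n k \<pi>) {1..k} (\<lambda>i y. y i) x"
  by (auto simp: suborbital_not_above_def prefix_union_def tuple_le_def not_le)

text \<open>
  Given a union of initial segments, lengthening each segment as far as possible inside the union
  yields an eligible tuple with the same union.
\<close>

lemma eligible_feasible_sets_eq_prefix_family:
  assumes \<pi>: "\<pi> \<in> perm_tuples n k"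
  shows "eligible_feasible_sets n k \<pi> =
    prefix_family (suborbital_vectors n k \<pi>) {1..k} (\<lambda>i y. y i)"
proof -
  let ?B = "suborbital_vectors n k \<pi>"
  let ?U = "prefix_union ?B {1..k} (\<lambda>i y. y i)"
  have "?U z \<in> ?U ` eligible_tuples n k \<pi>" for z
  proof -
    \<comment> \<open>\<open>S i\<close>: the admissible lengths of the \<open>i\<close>-th segment; the cap \<open>n\<close> makes the maximum exist\<close>
    define S where "S i = {m \<in> {..n}. {y \<in> ?B. y i < m} \<subseteq> ?U z}" for i
    define x where "x = (\<lambda>i\<in>{1..k}. Max (S i))"
    have finS: "finite (S i)" and "0 \<in> S i" for i by (auto simp: S_def)
    then have "Max (S i) \<in> S i" for i by (intro Max_in) auto
    then have xS: "x i \<in> S i" if "i \<in> {1..k}" for i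
      using that by (simp add: x_def)
    have xmax: "m \<le> x i" if "i \<in> {1..k}" "m \<in> S i" for i m
      using finS that by (simp add: x_def)
    have "?U x \<subseteq> ?U z"
    proof
      fix y assume "y \<in> ?U x"
      then obtain i where i: "y \<in> ?B" "i \<in> {1..k}" "y i < x i"
        by (auto simp: prefix_union_def)
      then show "y \<in> ?U z" using xS[OF i(2)] unfolding S_def by blast
    qed
    moreover have "?U z \<subseteq> ?U x"
    proof
      fix y assume "y \<in> ?U z"
      then obtain i where i: "y \<in> ?B" "i \<in> {1..k}" "y i < z i"
        by (auto simp: prefix_union_def)
      then have "y i < n" by (auto simp: suborbital_vectors_def PiE_iff)
      moreover have "min (z i) n \<in> S i" using i(2) by (auto simp: S_def prefix_union_def)
      ultimately have "y i < x i" using xmax[OF i(2)] i(3) by fastforce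
      then show "y \<in> ?U x" using i by (auto simp: prefix_union_def)
    qed
    ultimately have eq: "?U x = ?U z" by blast
    have "x \<in> eligible_tuples n k \<pi>"
      unfolding eligible_tuples_iff[OF \<pi>]
    proof (intro conjI ballI impI)
      show "x \<in> {1..k} \<rightarrow>\<^sub>E {0..n}"
        using xS by (auto simp: S_def x_def)
      fix i y assume iy: "i \<in> {1..k}" "y \<in> ?B" "y i = x i"
      show "tuple_le k x y"
      proof (rule ccontr)
        assume "\<not> tuple_le k x y"
        then have yU: "y \<in> ?U z"
          unfolding eq[symmetric] using iy by (auto simp: prefix_union_def tuple_le_def not_le)
        have "y i < n" using iy(1,2) by (auto simp: suborbital_vectors_def PiE_iff)
        then have "x i < n" using iy(3) by simp
        moreover have "y' \<in> ?U z" if "y' \<in> ?B" "y' i < Suc (x i)" for y'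
        proof (cases "y' i = x i")
          case True
          then have "y' = y"
            using bij_betw_imp_inj_on[OF bij_betw_suborbital_coordinate[OF \<pi> iy(1)]] iy that
            by (auto simp: inj_on_def)
          then show ?thesis using yU by simp
        next
          case False
          then show ?thesis using xS[OF iy(1)] that by (auto simp: S_def)
        qed
        \<comment> \<open>Since \<open>y\<close> is in the union, the \<open>i\<close>-th segment could be lengthened by \<open>y\<close>.\<close>
        ultimately have "Suc (x i) \<in> S i" by (auto simp: S_def)
        then show False using xmax[OF iy(1)] by fastforce
      qed
    qed
    then show ?thesis using eq by (metis imageI)
  qed
  then show ?thesis
    unfolding eligible_feasible_sets_def prefix_family_def suborbital_not_above_eq_prefix_union
    by blast
qed

lemma antimatroid_isomorphic_prefix_family:
  assumes f: "bij_betw f E E'" and r: "\<And>i e. i \<in> I \<Longrightarrow> e \<in> E \<Longrightarrow> s i (f e) = r i e"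
  shows "antimatroid_isomorphic E (prefix_family E I r) E' (prefix_family E' I s)"
proof -
  have "f ` prefix_union E I r z = prefix_union E' I s z" for z
    using bij_betw_imp_surj_on[OF f] r by (force simp: prefix_union_def)
  then have "(`) f ` prefix_family E I r = prefix_family E' I s"
    by (simp add: prefix_family_def image_image)
  moreover have "inj_on ((`) f) (prefix_family E I r)"
    by (rule inj_on_subset[OF inj_on_image_Pow[OF bij_betw_imp_inj_on[OF f]]])
      (auto simp: prefix_family_def prefix_union_def)
  ultimately show ?thesis
    using f unfolding antimatroid_isomorphic_def bij_betw_def by blast
qed

text \<open>
  The permutation \<open>\<pi>\<^bsub>1j\<^esub>\<close> turns the position of an element in the first order into its position in
  the \<open>j\<close>-th order, positions being counted from \<open>1\<close> here; this is what the function \<open>q j\<close> computes.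
\<close>

lemma rankings_as_suborbital_vectors:
  assumes r: "\<And>i. bij_betw (r i) E {0..<n}" and k: "k \<ge> 1"
  shows "\<exists>\<pi>\<in>perm_tuples n k. bij_betw (\<lambda>e. \<lambda>i\<in>{1..k}. r i e) E (suborbital_vectors n k \<pi>)"
proof -
  define q where
    "q j m = (if m \<in> {1..n} then r j (inv_into E (r 1) (m - 1)) + 1 else m)" for j m
  define \<pi> where "\<pi> = (\<lambda>j\<in>{2..k}. q j)"
  have up: "bij_betw Suc {0..<n} {1..n}" and down: "bij_betw (\<lambda>m. m - 1) {1..n} {0..<n}"
    by (rule bij_betw_byWitness[of _ "\<lambda>m. m - 1"], auto)
      (rule bij_betw_byWitness[of _ Suc], auto)
  have "q j permutes {1..n}" for j
  proof (rule bij_imp_permutes)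
    have "bij_betw (Suc \<circ> (r j \<circ> (inv_into E (r 1) \<circ> (\<lambda>m. m - 1)))) {1..n} {1..n}"
      by (intro bij_betw_trans[OF _ up] bij_betw_trans[OF _ r] bij_betw_trans[OF down]
          bij_betw_inv_into[OF r])
    then show "bij_betw (q j) {1..n} {1..n}"
      by (rule bij_betw_cong[THEN iffD1, rotated]) (simp add: q_def)
  qed (auto simp: q_def)
  then have \<pi>: "\<pi> \<in> perm_tuples n k" by (simp add: \<pi>_def perm_tuples_def)
  have r1: "r 1 e + 1 \<in> {1..n}" if "e \<in> E" for e
    using bij_betwE[OF r[of 1]] that by (auto simp: Suc_le_eq)
  have step: "perm_from_first \<pi> i (r 1 e + 1) = r i e + 1" if "i \<in> {1..k}" "e \<in> E" for i e
    using that r1[OF that(2)] bij_betw_inv_into_left[OF r that(2), of 1]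
    by (cases "i = 1") (auto simp: perm_from_first_def \<pi>_def q_def)
  let ?f = "\<lambda>e. \<lambda>i\<in>{1..k}. r i e"
  have "{1..n} = (\<lambda>e. r 1 e + 1) ` E"
    using bij_betw_imp_surj_on[OF bij_betw_trans[OF r[of 1] up]] by (simp add: comp_def)
  then have "suborbital_vectors n k \<pi> =
      (\<lambda>e. \<lambda>i\<in>{1..k}. perm_from_first \<pi> i (r 1 e + 1) - 1) ` E"
    unfolding suborbital_vectors_eq_image[OF \<pi> k] by (simp add: image_image)
  also have "\<dots> = ?f ` E" using step by (intro image_cong restrict_ext) auto
  finally have "?f ` E = suborbital_vectors n k \<pi>" ..
  moreover have "inj_on ?f E"
  proof (rule inj_onI)
    fix d e assume de: "d \<in> E" "e \<in> E" "?f d = ?f e"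
    from fun_cong[OF de(3), of 1] have "r 1 d = r 1 e" using k by simp
    then show "d = e" using bij_betw_imp_inj_on[OF r] de by (meson inj_onD)
  qed
  ultimately show ?thesis using \<pi> unfolding bij_betw_def by blast
qed

theorem corollary7p6:
  fixes n k :: nat
  assumes "n \<ge> 1" and "k \<ge> 2"
  shows "(\<forall>\<pi> \<in> perm_tuples n k.
            antimatroid (suborbital_vectors n k \<pi>) (eligible_feasible_sets n k \<pi>) \<and>
            convex_dimension (eligible_feasible_sets n k \<pi>) \<le> k) \<and>
         (\<forall>(E :: 'a set) F.
            antimatroid E F \<and> card E = n \<and> convex_dimension F = k \<longrightarrow>
            (\<exists>\<pi> \<in> perm_tuples n k.
               antimatroid_isomorphic E F
                 (suborbital_vectors n k \<pi>) (eligible_feasible_sets n k \<pi>)))"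
proof (intro conjI ballI allI impI)
  fix \<pi> assume \<pi>: "\<pi> \<in> perm_tuples n k"
  have coord: "bij_betw (\<lambda>y. y i) (suborbital_vectors n k \<pi>) {0..<n}" if "i \<in> {1..k}" for i
    using bij_betw_suborbital_coordinate[OF \<pi> that] .
  have fin: "finite (suborbital_vectors n k \<pi>)"
    using bij_betw_finite[OF coord[of 1]] assms by simp
  show "antimatroid (suborbital_vectors n k \<pi>) (eligible_feasible_sets n k \<pi>)"
    unfolding eligible_feasible_sets_eq_prefix_family[OF \<pi>]
    using fin assms coord by (intro antimatroid_prefix_family) (auto simp: bij_betw_def)
  show "convex_dimension (eligible_feasible_sets n k \<pi>) \<le> k"
    unfolding eligible_feasible_sets_eq_prefix_family[OF \<pi>]
    using convex_dimension_prefix_family[OF fin, of "{1..k}"] by simp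
next
  fix E :: "'a set" and F
  assume "antimatroid E F \<and> card E = n \<and> convex_dimension F = k"
  then obtain r where r: "\<And>i. bij_betw (r i) E {0..<n}" "F = prefix_family E {1..k} r"
    using antimatroid_as_prefix_family[of E F k] by auto
  obtain \<pi> where \<pi>: "\<pi> \<in> perm_tuples n k"
    "bij_betw (\<lambda>e. \<lambda>i\<in>{1..k}. r i e) E (suborbital_vectors n k \<pi>)"
    using rankings_as_suborbital_vectors[of r E n k] r(1) assms by auto
  have "antimatroid_isomorphic E F
      (suborbital_vectors n k \<pi>) (eligible_feasible_sets n k \<pi>)"
    unfolding r(2) eligible_feasible_sets_eq_prefix_family[OF \<pi>(1)]
    by (rule antimatroid_isomorphic_prefix_family[OF \<pi>(2)]) simp
  then show "\<exists>\<pi>\<in>perm_tuples n k. antimatroid_isomorphic E F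
      (suborbital_vectors n k \<pi>) (eligible_feasible_sets n k \<pi>)"
    using \<pi>(1) by blast
qed

end
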